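(* For every integer $n\ge 3$, $$|\operatorname{Av}_n(1\square 2)| = F_{n+1} = n+\sum_{k=1}^{n-3}\bigl(n-(k+2)F_{n-(k+1)}\bigr)\cdot k\cdot k!.$$
   Context: $F_i$ denotes the $i$-th Fibonacci number, with $F_1=F_2=1$ and $F_{i}=F_{i-1}+F_{i-2}$. $\operatorname{Av}_n(1\square 2)$ is the set of permutations $\pi=\pi_1\cdots\pi_n$ of $[n]$ for which there are no positions $i,j$ with $j\ge i+2$ and $\pi_i<\pi_j$. An empty sum is $0$. *)

theory Defs
  imports "HOL-Number_Theory.Fib" "HOL-Combinatorics.Permutations"
begin

(* A permutation of [n] is a function permuting {1..n} and fixing every other natural number,
   so these functions correspond one-to-one to the words p 1, ..., p n. *)
definition contains_1box2 :: "nat \<Rightarrow> (nat \<Rightarrow> nat) \<Rightarrow> bool" where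
  "contains_1box2 n p \<longleftrightarrow> (\<exists>i\<in>{1..n}. \<exists>j\<in>{1..n}. i + 2 \<le> j \<and> p i < p j)"

definition Av_1box2 :: "nat \<Rightarrow> (nat \<Rightarrow> nat) set" where
  "Av_1box2 n = {p. p permutes {1..n} \<and> \<not> contains_1box2 n p}"

end

(* Complementing the values turns the pattern condition into: q i < q j whenever j >= i + 2.
   For such a q on [n], either q fixes n, or q exchanges n - 1 and n; deleting these points
   gives the Fibonacci recursion.
   For the second equality, k * k! = (k + 1)! - k! and
   k (k + 2) k! = (k + 2)! - (k + 1)! - k!, so both parts of the sum telescope, the second one by
   the Fibonacci recursion. *)
theory Submission
  imports Defs
begin

section \<open>Reduction to almost increasing words by complementing values\<close>

definition gap_increasing :: "nat \<Rightarrow> (nat \<Rightarrow> nat) set" where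
  "gap_increasing n =
    {q. q permutes {1..n} \<and> (\<forall>i\<in>{1..n}. \<forall>j\<in>{1..n}. i + 2 \<le> j \<longrightarrow> q i < q j)}"

text \<open>Extended by the identity outside \<open>{1..n}\<close>, the reversal of values becomes
  an involution of all naturals and fits the convention of \<open>permutes\<close>.\<close>

definition complement :: "nat \<Rightarrow> nat \<Rightarrow> nat" where
  "complement n i = (if i \<in> {1..n} then n + 1 - i else i)"

lemma complement_complement: "complement n (complement n i) = i"
  by (auto simp: complement_def)

lemma complement_permutes: "complement n permutes {1..n}"
proof (rule bij_imp_permutes)
  show "bij_betw (complement n) {1..n} {1..n}"
    by (rule bij_betw_byWitness[where f' = "complement n"])
      (auto simp: complement_complement, auto simp: complement_def)
qed (auto simp: complement_def)

lemma complement_less_iff: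
  assumes "i \<in> {1..n}" "j \<in> {1..n}"
  shows "complement n i < complement n j \<longleftrightarrow> j < i"
  using assms by (auto simp: complement_def)

lemma complement_comp_in_gap_increasing:
  assumes "p \<in> Av_1box2 n"
  shows "complement n \<circ> p \<in> gap_increasing n"
proof -
  have p: "p permutes {1..n}" using assms by (simp add: Av_1box2_def)
  have "complement n (p i) < complement n (p j)"
    if ij: "i \<in> {1..n}" "j \<in> {1..n}" "i + 2 \<le> j" for i j
  proof -
    have "p i \<noteq> p j" using ij injD[OF permutes_inj[OF p], of i j] by auto
    moreover have "\<not> p i < p j" using assms ij by (auto simp: Av_1box2_def contains_1box2_def)
    ultimately have "p j < p i" by simp
    moreover have "p i \<in> {1..n}" "p j \<in> {1..n}"
      using permutes_in_image[OF p] ij by blast+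
    ultimately show ?thesis by (simp add: complement_less_iff)
  qed
  then show ?thesis
    using permutes_compose[OF p complement_permutes] by (simp add: gap_increasing_def)
qed

lemma complement_comp_in_Av_1box2:
  assumes "q \<in> gap_increasing n"
  shows "complement n \<circ> q \<in> Av_1box2 n"
proof -
  have q: "q permutes {1..n}" using assms by (simp add: gap_increasing_def)
  have "\<not> complement n (q i) < complement n (q j)"
    if ij: "i \<in> {1..n}" "j \<in> {1..n}" "i + 2 \<le> j" for i j
  proof -
    have "q i < q j" using assms ij by (simp add: gap_increasing_def)
    moreover have "q i \<in> {1..n}" "q j \<in> {1..n}"
      using permutes_in_image[OF q] ij by blast+
    ultimately show ?thesis by (simp add: complement_less_iff)
  qed
  then show ?thesis
    using permutes_compose[OF q complement_permutes]
    by (auto simp: Av_1box2_def contains_1box2_def)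
qed

text \<open>Since \<open>complement n\<close> is an involution, composing with it is its own
  inverse, so the same map serves in both directions of the bijection.\<close>

lemma card_Av_1box2_eq: "card (Av_1box2 n) = card (gap_increasing n)"
  by (rule bij_betw_same_card[of "\<lambda>p. complement n \<circ> p"],
      rule bij_betw_byWitness[where f' = "\<lambda>p. complement n \<circ> p"])
    (auto simp: fun_eq_iff complement_complement
      intro: complement_comp_in_gap_increasing complement_comp_in_Av_1box2)

section \<open>Fibonacci recursion for almost increasing permutations\<close>

lemma gap_increasing_Suc:
  assumes "q \<in> gap_increasing n"
  shows "q \<in> gap_increasing (Suc n)"
proof -
  have q: "q permutes {1..n}" using assms by (simp add: gap_increasing_def)
  have "q i < q j" if ij: "i \<in> {1..Suc n}" "j \<in> {1..Suc n}" "i + 2 \<le> j" for i j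
  proof (cases "j = Suc n")
    case True
    have "q i \<in> {1..n}" using permutes_in_image[OF q, of i] ij by auto
    moreover have "q j = j" using permutes_not_in[OF q, of j] True by simp
    ultimately show ?thesis using True by simp
  next
    case False
    then show ?thesis using assms ij by (auto simp: gap_increasing_def)
  qed
  moreover have "q permutes {1..Suc n}" using permutes_subset[OF q] by auto
  ultimately show ?thesis by (simp add: gap_increasing_def)
qed

text \<open>The exchanged positions are adjacent, so the gap condition never compares them with each
  other, and both carry values above \<open>n\<close>.\<close>

lemma gap_increasing_swap:
  assumes "q \<in> gap_increasing n"
  shows "q \<circ> transpose (Suc n) (Suc (Suc n)) \<in> gap_increasing (Suc (Suc n))"
proof -
  let ?t = "transpose (Suc n) (Suc (Suc n))"
  have q: "q permutes {1..n}" using assms by (simp add: gap_increasing_def)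
  have fix1: "q (Suc n) = Suc n" "q (Suc (Suc n)) = Suc (Suc n)"
    using permutes_not_in[OF q] by auto
  have "q (?t i) < q (?t j)"
    if ij: "i \<in> {1..Suc (Suc n)}" "j \<in> {1..Suc (Suc n)}" "i + 2 \<le> j" for i j
  proof -
    \<comment> \<open>The gap forces the left position to be at most \<open>n\<close>, so the
      transposition cannot move it.\<close>
    have i: "?t i = i" "i \<in> {1..n}" using ij by (auto simp: transpose_def)
    then have qi: "q i \<in> {1..n}" using permutes_in_image[OF q, of i] by auto
    show ?thesis
    proof (cases "j \<le> n")
      case True
      then show ?thesis using assms ij i by (auto simp: gap_increasing_def transpose_def)
    next
      case False
      then have "j = Suc n \<or> j = Suc (Suc n)" using ij by auto
      then show ?thesis using i qi fix1 by (auto simp: transpose_def)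
    qed
  qed
  moreover have "q \<circ> ?t permutes {1..Suc (Suc n)}"
    using permutes_subset[OF q, of "{1..Suc (Suc n)}"]
    by (intro permutes_compose permutes_swap_id) auto
  ultimately show ?thesis by (simp add: gap_increasing_def)
qed

text \<open>Deleting fixed top points needs no renumbering. This is the gain from complementing: in
  the original class, removing the last entry would require shifting the values.\<close>

lemma gap_increasing_restrict:
  assumes "q \<in> gap_increasing n" "m \<le> n" "\<And>i. m < i \<Longrightarrow> i \<le> n \<Longrightarrow> q i = i"
  shows "q \<in> gap_increasing m"
proof -
  have "q permutes {1..m}"
    by (rule permutes_superset[of q "{1..n}"]) (use assms in \<open>auto simp: gap_increasing_def\<close>)
  then show ?thesis using assms(1,2) by (auto simp: gap_increasing_def)
qed

text \<open>Every position up to \<open>n\<close> is at distance at least 2 from the last one and so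
  has a smaller value there; hence the maximum can only occupy one of the last two
  positions.\<close>

lemma gap_increasing_cases:
  assumes "q \<in> gap_increasing (Suc (Suc n))"
  shows "q (Suc (Suc n)) = Suc (Suc n) \<or>
    q (Suc n) = Suc (Suc n) \<and> q (Suc (Suc n)) = Suc n"
proof -
  let ?N = "Suc (Suc n)"
  have q: "q permutes {1..?N}" using assms by (simp add: gap_increasing_def)
  have mono: "q i < q ?N" if "1 \<le> i" "i \<le> n" for i
    using assms that by (auto simp: gap_increasing_def)
  have qN: "q ?N \<le> ?N" using permutes_in_image[OF q, of ?N] by auto
  have surj: "\<exists>i\<in>{1..?N}. q i = v" if "v \<in> {1..?N}" for v
    using permutes_image[OF q] that by (metis imageE)
  obtain k where k: "k \<in> {1..?N}" "q k = ?N" using surj[of ?N] by auto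
  have "\<not> k \<le> n" using mono[of k] k qN by auto
  then have "k = Suc n \<or> k = ?N" using k by auto
  moreover have "q ?N = Suc n" if "k = Suc n"
  proof -
    obtain j where j: "j \<in> {1..?N}" "q j = Suc n" using surj[of "Suc n"] by auto
    \<comment> \<open>The maximum is already used at \<open>Suc n\<close>. If the value
      \<open>Suc n\<close> stood at a position up to \<open>n\<close>, the last value would have to
      exceed it and be the maximum again.\<close>
    have "q ?N \<noteq> ?N" using k that injD[OF permutes_inj[OF q], of ?N k] by auto
    then have "\<not> j \<le> n" using mono[of j] j qN by auto
    moreover have "j \<noteq> Suc n" using j k that by auto
    ultimately have "j = ?N" using j by auto
    then show ?thesis using j by simp
  qed
  ultimately show ?thesis using k by auto
qed

lemma gap_increasing_Suc_Suc:
  "gap_increasing (Suc (Suc n)) =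
    gap_increasing (Suc n) \<union>
    (\<lambda>q. q \<circ> transpose (Suc n) (Suc (Suc n))) ` gap_increasing n"
  (is "?A = ?B \<union> ?f ` ?C")
proof (intro equalityI subsetI)
  fix q assume q: "q \<in> ?A"
  let ?t = "transpose (Suc n) (Suc (Suc n))"
  from gap_increasing_cases[OF q] show "q \<in> ?B \<union> ?f ` ?C"
  proof
    assume *: "q (Suc (Suc n)) = Suc (Suc n)"
    have "q \<in> ?B"
    proof (rule gap_increasing_restrict[OF q])
      fix i assume "Suc n < i" "i \<le> Suc (Suc n)"
      then have "i = Suc (Suc n)" by simp
      then show "q i = i" using * by simp
    qed simp
    then show ?thesis ..
  next
    assume *: "q (Suc n) = Suc (Suc n) \<and> q (Suc (Suc n)) = Suc n"
    \<comment> \<open>Precomposing with the transposition undoes the exchange, so the composite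
      fixes both top points.\<close>
    have perm: "q \<circ> ?t permutes {1..Suc (Suc n)}"
      using q by (intro permutes_compose permutes_swap_id) (auto simp: gap_increasing_def)
    have "q \<circ> ?t permutes {1..n}"
    proof (rule permutes_superset[OF perm])
      fix i assume "i \<in> {1..Suc (Suc n)} - {1..n}"
      then have "i = Suc n \<or> i = Suc (Suc n)" by auto
      then show "(q \<circ> ?t) i = i" using * by auto
    qed
    moreover have "(q \<circ> ?t) i < (q \<circ> ?t) j"
      if "i \<in> {1..n}" "j \<in> {1..n}" "i + 2 \<le> j" for i j
      using q that by (auto simp: gap_increasing_def transpose_def)
    ultimately have "q \<circ> ?t \<in> ?C" by (simp add: gap_increasing_def)
    moreover have "q = ?f (q \<circ> ?t)" by (simp add: fun_eq_iff)
    ultimately show ?thesis by blast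
  qed
next
  fix q assume "q \<in> ?B \<union> ?f ` ?C"
  then show "q \<in> ?A" using gap_increasing_Suc gap_increasing_swap by auto
qed

lemma finite_gap_increasing: "finite (gap_increasing n)"
  by (rule finite_subset[OF _ finite_permutations[of "{1..n}"]]) (auto simp: gap_increasing_def)

lemma card_gap_increasing_Suc_Suc:
  "card (gap_increasing (Suc (Suc n))) = card (gap_increasing (Suc n)) + card (gap_increasing n)"
proof -
  let ?t = "transpose (Suc n) (Suc (Suc n))"
  \<comment> \<open>The value at \<open>Suc (Suc n)\<close> separates the two families: it is fixed
    in the first and sent to \<open>Suc n\<close> in the second.\<close>
  have "gap_increasing (Suc n) \<inter> (\<lambda>q. q \<circ> ?t) ` gap_increasing n = {}"
  proof -
    have "q (Suc (Suc n)) = Suc (Suc n)" if "q \<in> gap_increasing (Suc n)" for q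
      using that permutes_not_in[of q "{1..Suc n}" "Suc (Suc n)"]
      by (auto simp: gap_increasing_def)
    moreover have "(q \<circ> ?t) (Suc (Suc n)) = Suc n" if "q \<in> gap_increasing n" for q
      using that permutes_not_in[of q "{1..n}" "Suc n"] by (auto simp: gap_increasing_def)
    ultimately show ?thesis by fastforce
  qed
  moreover have "inj_on (\<lambda>q. q \<circ> ?t) (gap_increasing n)"
    by (rule inj_on_inverseI[where g = "\<lambda>q. q \<circ> ?t"]) (simp add: fun_eq_iff)
  ultimately show ?thesis
    by (simp add: gap_increasing_Suc_Suc card_Un_disjoint finite_gap_increasing card_image)
qed

lemma card_gap_increasing: "card (gap_increasing n) = fib (n + 1)"
proof (induction n rule: fib.induct)
  case 1
  have "gap_increasing 0 = {id}" by (auto simp: gap_increasing_def)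
  then show ?case by simp
next
  case 2
  have "gap_increasing (Suc 0) = {id}" by (auto simp: gap_increasing_def)
  then show ?case by simp
next
  case (3 n)
  then show ?case by (simp add: card_gap_increasing_Suc_Suc)
qed

section \<open>Telescoping sums and the second equality\<close>

lemma sum_mult_fact_telescope: "1 + (\<Sum>k = 1..m. k * fact k) = (fact (Suc m) :: nat)"
  by (induction m) (simp_all add: algebra_simps)

text \<open>For \<open>m = 0\<close> the right side is \<open>fib (n + 1)\<close> with the recursion
  unfolded twice. Raising \<open>m\<close> unfolds the larger Fibonacci number once more, and the
  new summand completes its coefficient to the next factorial.\<close>

lemma sum_fib_fact_telescope:
  assumes "m + 2 \<le> n"
  shows "fib (n + 1) + (\<Sum>k = 1..m. (k + 2) * fib (n - (k + 1)) * k * fact k) =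
    fact (m + 2) * fib (n - (m + 1)) + fact (m + 1) * fib (n - (m + 2))"
  using assms
proof (induction m)
  case 0
  then obtain r where "n = 2 + r" by (auto dest: le_Suc_ex)
  then show ?case by simp
next
  case (Suc m)
  \<comment> \<open>Writing \<open>n\<close> as \<open>r + m + 3\<close> turns every truncated
    subtraction in the indices into an exact sum.\<close>
  define r where "r = n - (m + 3)"
  have n: "n = r + m + 3" using Suc.prems by (simp add: r_def)
  have IH: "fib (n + 1) + (\<Sum>k = 1..m. (k + 2) * fib (n - (k + 1)) * k * fact k) =
      fact (m + 2) * fib (r + 2) + fact (m + 1) * fib (r + 1)"
    using Suc.IH by (simp add: n numeral_2_eq_2 numeral_3_eq_3)
  have sum_Suc: "(\<Sum>k = 1..Suc m. (k + 2) * fib (n - (k + 1)) * k * fact k) =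
      (\<Sum>k = 1..m. (k + 2) * fib (n - (k + 1)) * k * fact k)
      + (m + 3) * fib (r + 1) * (m + 1) * fact (m + 1)"
    by (simp add: n numeral_3_eq_3)
  have step: "fact (m + 2) * fib (r + 2) + fact (m + 1) * fib (r + 1)
      + (m + 3) * fib (r + 1) * (m + 1) * fact (m + 1) =
      fact (m + 3) * fib (r + 1) + fact (m + 2) * fib r"
    by (simp add: numeral_2_eq_2 numeral_3_eq_3 algebra_simps)
  have shift: "Suc m + 2 = m + 3" "Suc m + 1 = m + 2"
    "n - (m + 2) = r + 1" "n - (m + 3) = r"
    by (simp_all add: n)
  show ?case
    unfolding sum_Suc shift
    by (simp only: add.assoc[symmetric] IH step)
qed

theorem mainTheorem2:
  fixes n :: nat
  assumes "n \<ge> 3"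
  shows "card (Av_1box2 n) = fib (n + 1) \<and>
    int (fib (n + 1)) =
      int n + (\<Sum>k = 1..n - 3. (int n - int (k + 2) * int (fib (n - (k + 1)))) * int k * fact k)"
proof
  show "card (Av_1box2 n) = fib (n + 1)"
    by (simp only: card_Av_1box2_eq card_gap_increasing)
next
  define m where "m = n - 3"
  have n: "n = m + 3" using assms by (simp add: m_def)
  let ?S = "\<Sum>k = 1..m. k * fact k :: nat"
  let ?T = "\<Sum>k = 1..m. (k + 2) * fib (n - (k + 1)) * k * fact k"
  \<comment> \<open>For \<open>m = n - 3\<close> the remaining Fibonacci numbers are
    \<open>fib 2\<close> and \<open>fib 1\<close>, both equal to 1.\<close>
  have "fib (n + 1) + ?T = fact (m + 2) + fact (m + 1)"
    using sum_fib_fact_telescope[of m n] by (simp add: n numeral_2_eq_2 numeral_3_eq_3)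
  also have "\<dots> = n * fact (Suc m)" by (simp add: n algebra_simps)
  also have "\<dots> = n + n * ?S"
    using sum_mult_fact_telescope[of m, symmetric] by (simp only: distrib_left mult_1_right)
  \<comment> \<open>The identity is proved over the naturals with sums only; the integers are needed
    for the differences in the claim, which can be negative (for \<open>n = 5\<close> and
    \<open>k = 1\<close> the factor is -1).\<close>
  finally have "int (fib (n + 1)) + int ?T = int n + int n * int ?S"
    by (simp only: of_nat_add[symmetric] of_nat_mult[symmetric])
  moreover have "(\<Sum>k = 1..m. (int n - int (k + 2) * int (fib (n - (k + 1)))) * int k * fact k) =
      int n * int ?S - int ?T"
    by (simp only: sum_distrib_left sum_subtractf[symmetric] of_nat_sum of_nat_mult of_nat_fact
        left_diff_distrib mult.assoc)
  ultimately show "int (fib (n + 1)) =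
      int n + (\<Sum>k = 1..n - 3. (int n - int (k + 2) * int (fib (n - (k + 1)))) * int k * fact k)"
    by (simp add: m_def[symmetric])
qed

end
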